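(* Let $\alpha_1,\alpha_2\in R$ and let $\partial_1,\partial_2$ be divided difference operators corresponding to the elements $\alpha_1,\alpha_2$. Let $\pi_1=1-\alpha_1\partial_1$ and $\pi_2=1-\alpha_2\partial_2$ be the corresponding multiplicative projectors. The operation $$\mu_1(x,y)=\pi_1(x)\pi_2(y)=xy-\alpha_1\partial_1(x)y-\alpha_2\partial_2(y)x+\alpha_1\alpha_2\partial_1(x)\partial_2(y)$$ determines an associative product if and only if $\partial_1$ and $\partial_2$ are division operators and the multiplicative projectors $\pi_1$ and $\pi_2$ commute, i.e. $\pi_1\pi_2=\pi_2\pi_1$. In particular, each division operator $\partial$ determines the associative product $\mu(x,y)=\pi(x)\pi(y)$, where $\pi=1-\alpha\partial$. The product $\mu_1(x,y)$ is commutative if and only if $\pi_1=\pi_2$.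
   Context: $K$ is a commutative associative ring with unit, $R\supset K$ is a commutative associative ring with the same unit, and both are integral domains; all operators $R\to R$ are $K$-linear. It is assumed that $\bigcap_n \alpha^nR=0$ for every noninvertible $\alpha\in R$. A divided difference operator corresponding to $\alpha\in R$, where $\alpha$ is not invertible in $R$, is a $K$-linear operator $\partial:R\to R$, not identically trivial, such that $\partial(xy)=(\partial x)y+x(\partial y)-\alpha(\partial x)(\partial y)$ for all $x,y\in R$. It is a division operator (by $\alpha$) if moreover $\partial(\alpha)=1$. An operator $\pi:R\to R$ is multiplicative if $\pi(xy)=\pi(x)\pi(y)$ for all $x,y\in R$; it is a projector if $\pi^2=\pi$.
   Formalization: The associativity criterion is stated for nonzero α₁, α₂ (it fails for α₁=α₂=0, ∂₁=∂₂=d/dx on Q[x]); π₁, π₂ are shown multiplicative, and being a projector, which is not automatic, is claimed only for division operators. *)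

theory Defs
  imports Main
begin

text \<open>
  The ring R is a type of class \<open>idom\<close>; the ground ring K is a subset of it.
  A subring of R containing 1 is automatically a commutative integral domain.
\<close>

definition unital_subring :: "'r::idom set \<Rightarrow> bool" where
  "unital_subring K \<longleftrightarrow> 1 \<in> K \<and> (\<forall>x\<in>K. \<forall>y\<in>K. x - y \<in> K \<and> x * y \<in> K)"

definition linear_over :: "'r::idom set \<Rightarrow> ('r \<Rightarrow> 'r) \<Rightarrow> bool" where
  "linear_over K f \<longleftrightarrow>
     (\<forall>x y. f (x + y) = f x + f y) \<and> (\<forall>k\<in>K. \<forall>x. f (k * x) = k * f x)"

definition divided_difference_operator :: "'r::idom set \<Rightarrow> 'r \<Rightarrow> ('r \<Rightarrow> 'r) \<Rightarrow> bool" where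
  "divided_difference_operator K \<alpha> D \<longleftrightarrow>
     \<not> \<alpha> dvd 1 \<and> linear_over K D \<and> (\<exists>x. D x \<noteq> 0) \<and>
     (\<forall>x y. D (x * y) = D x * y + x * D y - \<alpha> * D x * D y)"

definition division_operator :: "'r::idom set \<Rightarrow> 'r \<Rightarrow> ('r \<Rightarrow> 'r) \<Rightarrow> bool" where
  "division_operator K \<alpha> D \<longleftrightarrow> divided_difference_operator K \<alpha> D \<and> D \<alpha> = 1"

definition multiplicative :: "('r::idom \<Rightarrow> 'r) \<Rightarrow> bool" where
  "multiplicative P \<longleftrightarrow> (\<forall>x y. P (x * y) = P x * P y)"

definition projector :: "('r::idom \<Rightarrow> 'r) \<Rightarrow> bool" where
  "projector P \<longleftrightarrow> P \<circ> P = P"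

text \<open>
  The operator \<open>1 - \<alpha> D\<close>. It is multiplicative for every divided difference operator
  D, but it need not be a projector unless D is a division operator.
\<close>

definition pi_op :: "'r::idom \<Rightarrow> ('r \<Rightarrow> 'r) \<Rightarrow> 'r \<Rightarrow> 'r" where
  "pi_op \<alpha> D = (\<lambda>x. x - \<alpha> * D x)"

definition mu_op :: "'r::idom \<Rightarrow> ('r \<Rightarrow> 'r) \<Rightarrow> 'r \<Rightarrow> ('r \<Rightarrow> 'r) \<Rightarrow> 'r \<Rightarrow> 'r \<Rightarrow> 'r" where
  "mu_op \<alpha>\<^sub>1 D\<^sub>1 \<alpha>\<^sub>2 D\<^sub>2 = (\<lambda>x y. pi_op \<alpha>\<^sub>1 D\<^sub>1 x * pi_op \<alpha>\<^sub>2 D\<^sub>2 y)"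

end

theory Submission
  imports Defs
begin

text \<open>
  Write \<open>\<pi> = 1 - \<alpha> D\<close>, which is multiplicative with \<open>\<pi> 1 = 1\<close>. Associativity of
  \<open>\<pi>\<^sub>1 x * \<pi>\<^sub>2 y\<close> reads
  \<open>\<pi>\<^sub>1\<pi>\<^sub>1 x * \<pi>\<^sub>1\<pi>\<^sub>2 y * \<pi>\<^sub>2 z = \<pi>\<^sub>1 x * \<pi>\<^sub>2\<pi>\<^sub>1 y * \<pi>\<^sub>2\<pi>\<^sub>2 z\<close>, and setting two of the three
  variables to 1 splits it into: both \<open>\<pi>\<^sub>i\<close> are projectors, and they commute. Moreover,
  \<open>\<pi>\<close> is a projector iff \<open>\<pi> \<alpha> * \<pi> (D x) = 0\<close> for all \<open>x\<close>. If \<open>\<pi> \<alpha> \<noteq> 0\<close>, this gives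
  \<open>D x = \<alpha> * D (D x)\<close>, so every \<open>D x\<close> is divisible by all powers of \<open>\<alpha>\<close>, hence zero.
  Thus \<open>\<pi> \<alpha> = 0\<close>, which for \<open>\<alpha> \<noteq> 0\<close> means \<open>D \<alpha> = 1\<close>.
\<close>

lemma multiplicativeD: "multiplicative P \<Longrightarrow> P (x * y) = P x * P y"
  by (simp add: multiplicative_def)

lemma projectorD: "projector P \<Longrightarrow> P (P x) = P x"
  by (metis projector_def comp_apply)

lemma multiplicative_pi_op:
  assumes "divided_difference_operator K \<alpha> D"
  shows "multiplicative (pi_op \<alpha> D)"
proof -
  have "D (x * y) = D x * y + x * D y - \<alpha> * D x * D y" for x y
    using assms by (simp add: divided_difference_operator_def)
  then show ?thesis
    by (simp only: multiplicative_def pi_op_def) (simp add: algebra_simps)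
qed

text \<open>In a domain one factor of \<open>D 1 * (1 - \<alpha> * D 1)\<close> must vanish. It
  cannot be the second, which would make \<alpha> invertible, so \<open>D 1 = 0\<close>.\<close>

lemma pi_op_one:
  assumes "divided_difference_operator K \<alpha> D"
  shows "pi_op \<alpha> D 1 = 1"
proof -
  have "D (1 * 1) = D 1 * 1 + 1 * D 1 - \<alpha> * D 1 * D 1"
    using assms unfolding divided_difference_operator_def by blast
  then have "D 1 * (1 - \<alpha> * D 1) = 0"
    by (simp add: algebra_simps)
  moreover have "1 - \<alpha> * D 1 \<noteq> 0"
    using assms by (metis divided_difference_operator_def dvd_triv_left eq_iff_diff_eq_0)
  ultimately show ?thesis
    by (simp add: pi_op_def)
qed

lemma pi_op_diff:
  assumes "linear_over K D"
  shows "pi_op \<alpha> D (x - y) = pi_op \<alpha> D x - pi_op \<alpha> D y"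
proof -
  have "D ((x - y) + y) = D (x - y) + D y"
    using assms unfolding linear_over_def by blast
  then show ?thesis
    by (simp add: pi_op_def algebra_simps)
qed

text \<open>Applying the additive and multiplicative \<open>pi_op \<alpha> D\<close> to
  \<open>x - \<alpha> * D x\<close> shows that this product is exactly the defect of idempotency at
  \<open>x\<close>.\<close>

lemma projector_pi_op_iff:
  assumes "divided_difference_operator K \<alpha> D"
  shows "projector (pi_op \<alpha> D) \<longleftrightarrow> (\<forall>x. pi_op \<alpha> D \<alpha> * pi_op \<alpha> D (D x) = 0)"
proof -
  have "linear_over K D"
    using assms by (simp add: divided_difference_operator_def)
  have "pi_op \<alpha> D (pi_op \<alpha> D x) = pi_op \<alpha> D x - pi_op \<alpha> D \<alpha> * pi_op \<alpha> D (D x)" for x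
  proof -
    have "pi_op \<alpha> D (pi_op \<alpha> D x) = pi_op \<alpha> D (x - \<alpha> * D x)"
      by (simp only: pi_op_def)
    then show ?thesis
      using pi_op_diff[OF \<open>linear_over K D\<close>] multiplicativeD[OF multiplicative_pi_op[OF assms]]
      by simp
  qed
  then show ?thesis
    by (simp add: projector_def fun_eq_iff)
qed

lemma projector_pi_op_division:
  assumes "division_operator K \<alpha> D"
  shows "projector (pi_op \<alpha> D)"
proof -
  have "divided_difference_operator K \<alpha> D" "pi_op \<alpha> D \<alpha> = 0"
    using assms by (simp_all add: division_operator_def pi_op_def)
  then show ?thesis
    by (simp add: projector_pi_op_iff)
qed

lemma division_operator_if_projector:
  assumes separated: "(\<Inter>n::nat. range (\<lambda>r. \<alpha> ^ n * r)) = {0}"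
    and D: "divided_difference_operator K \<alpha> D"
    and "\<alpha> \<noteq> 0"
    and proj: "projector (pi_op \<alpha> D)"
  shows "division_operator K \<alpha> D"
proof -
  have "pi_op \<alpha> D \<alpha> = 0"
  proof (rule ccontr)
    assume "pi_op \<alpha> D \<alpha> \<noteq> 0"
    then have "D x = \<alpha> * D (D x)" for x
      using proj projector_pi_op_iff[OF D] by (simp add: pi_op_def)
    \<comment> \<open>The cofactor is kept in the range of \<open>D\<close>, so the identity applies
      to it again; the witness is the \<open>n\<close>-th iterate of \<open>D\<close> at
      \<open>x\<close>.\<close>
    then have "\<exists>z. D x = \<alpha> ^ n * D z" for n x
      by (induction n) (metis mult_1 power_0, metis mult.assoc power_Suc2)
    then have "D x \<in> (\<Inter>n::nat. range (\<lambda>r. \<alpha> ^ n * r))" for x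
      by blast
    then have "D x = 0" for x
      using separated by blast
    then show False
      using D by (simp add: divided_difference_operator_def)
  qed
  with \<open>\<alpha> \<noteq> 0\<close> D show ?thesis
    by (simp add: division_operator_def pi_op_def)
qed

text \<open>Both bracketings reduce to \<open>P x * P (Q y) * Q z\<close>.\<close>

lemma semigroup_projectors:
  assumes "multiplicative P" "multiplicative Q" "projector P" "projector Q" "P \<circ> Q = Q \<circ> P"
  shows "semigroup (\<lambda>x y. P x * Q y)"
proof
  have "P (Q x) = Q (P x)" for x
    using assms(5) by (metis comp_apply)
  then show "P (P x * Q y) * Q z = P x * Q (P y * Q z)" for x y z
    by (simp add: multiplicativeD assms(1,2) projectorD assms(3,4) mult.assoc)
qed

lemma semigroup_product_iff:
  assumes "multiplicative P" "multiplicative Q" "P 1 = 1" "Q 1 = 1"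
  shows "semigroup (\<lambda>x y. P x * Q y) \<longleftrightarrow> projector P \<and> projector Q \<and> P \<circ> Q = Q \<circ> P"
proof
  assume "semigroup (\<lambda>x y. P x * Q y)"
  then have "P (P x * Q y) * Q z = P x * Q (P y * Q z)" for x y z
    by (rule semigroup.assoc)
  \<comment> \<open>These instances yield, in order, idempotency of \<open>P\<close>, idempotency of
    \<open>Q\<close>, and \<open>P (Q y) = Q (P y)\<close>.\<close>
  from this[of _ 1 1] this[of 1 1] this[of 1 _ 1]
  show "projector P \<and> projector Q \<and> P \<circ> Q = Q \<circ> P"
    by (simp add: assms(3,4) projector_def fun_eq_iff)
qed (use assms semigroup_projectors in blast)

text \<open>Setting \<open>y = 1\<close> isolates \<open>P x\<close> on one side and
  \<open>Q x\<close> on the other.\<close>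

lemma commutative_product_iff:
  fixes P Q :: "'r::idom \<Rightarrow> 'r"
  assumes "P 1 = 1" "Q 1 = 1"
  shows "(\<forall>x y. P x * Q y = P y * Q x) \<longleftrightarrow> P = Q"
proof
  assume "\<forall>x y. P x * Q y = P y * Q x"
  then have "P x * Q 1 = P 1 * Q x" for x
    by blast
  then show "P = Q"
    by (simp add: assms fun_eq_iff)
qed (simp add: mult.commute)

text \<open>The associativity criterion excludes \<alpha> = 0: there \<open>pi_op\<close> is the
  identity, while additivity forces \<open>D 0 = 0\<close>. With both parameters zero the product is
  ordinary multiplication, associative without division operators.\<close>

theorem theorem1:
  fixes K :: "'r::idom set"
    and \<alpha>\<^sub>1 \<alpha>\<^sub>2 :: 'r
    and D\<^sub>1 D\<^sub>2 :: "'r \<Rightarrow> 'r"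
  assumes "unital_subring K"
    and "\<And>\<alpha>::'r. \<not> \<alpha> dvd 1 \<Longrightarrow> (\<Inter>n::nat. range (\<lambda>r. \<alpha> ^ n * r)) = {0}"
    and "divided_difference_operator K \<alpha>\<^sub>1 D\<^sub>1"
    and "divided_difference_operator K \<alpha>\<^sub>2 D\<^sub>2"
  shows "multiplicative (pi_op \<alpha>\<^sub>1 D\<^sub>1) \<and> multiplicative (pi_op \<alpha>\<^sub>2 D\<^sub>2) \<and>
    (\<forall>x y. mu_op \<alpha>\<^sub>1 D\<^sub>1 \<alpha>\<^sub>2 D\<^sub>2 x y =
       x * y - \<alpha>\<^sub>1 * D\<^sub>1 x * y - \<alpha>\<^sub>2 * D\<^sub>2 y * x + \<alpha>\<^sub>1 * \<alpha>\<^sub>2 * D\<^sub>1 x * D\<^sub>2 y) \<and>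
    (\<alpha>\<^sub>1 \<noteq> 0 \<and> \<alpha>\<^sub>2 \<noteq> 0 \<longrightarrow>
      (semigroup (mu_op \<alpha>\<^sub>1 D\<^sub>1 \<alpha>\<^sub>2 D\<^sub>2) \<longleftrightarrow>
         division_operator K \<alpha>\<^sub>1 D\<^sub>1 \<and> division_operator K \<alpha>\<^sub>2 D\<^sub>2 \<and>
         pi_op \<alpha>\<^sub>1 D\<^sub>1 \<circ> pi_op \<alpha>\<^sub>2 D\<^sub>2 = pi_op \<alpha>\<^sub>2 D\<^sub>2 \<circ> pi_op \<alpha>\<^sub>1 D\<^sub>1)) \<and>
    (\<forall>\<alpha> D. division_operator K \<alpha> D \<longrightarrow>
       projector (pi_op \<alpha> D) \<and> semigroup (mu_op \<alpha> D \<alpha> D)) \<and>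
    ((\<forall>x y. mu_op \<alpha>\<^sub>1 D\<^sub>1 \<alpha>\<^sub>2 D\<^sub>2 x y = mu_op \<alpha>\<^sub>1 D\<^sub>1 \<alpha>\<^sub>2 D\<^sub>2 y x) \<longleftrightarrow>
       pi_op \<alpha>\<^sub>1 D\<^sub>1 = pi_op \<alpha>\<^sub>2 D\<^sub>2)"
proof -
  let ?P = "pi_op \<alpha>\<^sub>1 D\<^sub>1" and ?Q = "pi_op \<alpha>\<^sub>2 D\<^sub>2"
  note D = assms(3,4)
  note mult = D[THEN multiplicative_pi_op] and one = D[THEN pi_op_one]
  have "\<not> \<alpha>\<^sub>1 dvd 1" "\<not> \<alpha>\<^sub>2 dvd 1"
    using D by (simp_all add: divided_difference_operator_def)
  note separated = this[THEN assms(2)]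
  have expansion: "mu_op \<alpha>\<^sub>1 D\<^sub>1 \<alpha>\<^sub>2 D\<^sub>2 x y =
      x * y - \<alpha>\<^sub>1 * D\<^sub>1 x * y - \<alpha>\<^sub>2 * D\<^sub>2 y * x + \<alpha>\<^sub>1 * \<alpha>\<^sub>2 * D\<^sub>1 x * D\<^sub>2 y" for x y
    by (simp add: mu_op_def pi_op_def algebra_simps)
  have assoc: "semigroup (mu_op \<alpha>\<^sub>1 D\<^sub>1 \<alpha>\<^sub>2 D\<^sub>2) \<longleftrightarrow>
      division_operator K \<alpha>\<^sub>1 D\<^sub>1 \<and> division_operator K \<alpha>\<^sub>2 D\<^sub>2 \<and> ?P \<circ> ?Q = ?Q \<circ> ?P"
    if "\<alpha>\<^sub>1 \<noteq> 0" "\<alpha>\<^sub>2 \<noteq> 0"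
  proof -
    have "projector ?P \<longleftrightarrow> division_operator K \<alpha>\<^sub>1 D\<^sub>1" "projector ?Q \<longleftrightarrow> division_operator K \<alpha>\<^sub>2 D\<^sub>2"
      using division_operator_if_projector[OF separated(1) D(1)]
        division_operator_if_projector[OF separated(2) D(2)]
        projector_pi_op_division that by blast+
    then show ?thesis
      unfolding mu_op_def using semigroup_product_iff[OF mult one] by simp
  qed
  have division: "projector (pi_op \<alpha> D) \<and> semigroup (mu_op \<alpha> D \<alpha> D)"
    if "division_operator K \<alpha> D" for \<alpha> D
  proof -
    have "projector (pi_op \<alpha> D)" "multiplicative (pi_op \<alpha> D)"
      using that projector_pi_op_division multiplicative_pi_op division_operator_def by blast+
    then show ?thesis
      \<comment> \<open>Both projectors coincide here, so they commute trivially.\<close>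
      unfolding mu_op_def using semigroup_projectors by blast
  qed
  have "(\<forall>x y. mu_op \<alpha>\<^sub>1 D\<^sub>1 \<alpha>\<^sub>2 D\<^sub>2 x y = mu_op \<alpha>\<^sub>1 D\<^sub>1 \<alpha>\<^sub>2 D\<^sub>2 y x) \<longleftrightarrow> ?P = ?Q"
    unfolding mu_op_def using commutative_product_iff one by blast
  with mult expansion assoc division show ?thesis
    by blast
qed

end
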